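(* Let $\mathcal{S}$ and $\mathcal{T}$ be numerical semigroups and let $c,d$ be positive integers with $\gcd(c,d)=1$. Then $$\frac{\mathcal{S}}{c}+\frac{\mathcal{T}}{d}=\frac{d\,\mathcal{S}+c\,\mathcal{T}}{cd}.$$
   Context: Here $\mathbb{N}=\{0,1,2,\dots\}$. A numerical semigroup is a subset of $\mathbb{N}$ containing $0$ and closed under addition (finite complement in $\mathbb{N}$ is not required). For a numerical semigroup $\mathcal{U}$ and a positive integer $m$, the quotient is $\frac{\mathcal{U}}{m}=\{t\in\mathbb{N}: mt\in\mathcal{U}\}$ and the dilate is $m\,\mathcal{U}=\{mu: u\in\mathcal{U}\}$. The sum of two numerical semigroups is $\mathcal{U}+\mathcal{V}=\{u+v: u\in\mathcal{U},\ v\in\mathcal{V}\}$. All of these are again numerical semigroups. *)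

theory Defs
  imports Main "HOL-Library.Set_Algebras"
begin

text \<open>
  The sum of two semigroups is the elementwise sum \<open>U + V\<close> of sets and the dilate \<open>m U\<close> is
  \<open>m *o U\<close>, both from \<open>Set_Algebras\<close>.
\<close>

text \<open>Finite complement in the natural numbers is not required.\<close>

definition numerical_semigroup :: "nat set \<Rightarrow> bool" where
  "numerical_semigroup U \<longleftrightarrow> 0 \<in> U \<and> (\<forall>x\<in>U. \<forall>y\<in>U. x + y \<in> U)"

definition semigroup_quotient :: "nat set \<Rightarrow> nat \<Rightarrow> nat set" where
  "semigroup_quotient U m = {t. m * t \<in> U}"

end

theory Submission
  imports Defs
begin

text \<open>Clearing denominators in \<open>t = a + b\<close> gives
  \<open>c * d * t = d * (c * a) + c * (d * b)\<close>, which yields the inclusion from left to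
  right. Conversely, a representation \<open>c * d * t = d * s + c * u\<close> read modulo
  \<open>c\<close> and modulo \<open>d\<close> forces, by coprimality, \<open>c dvd s\<close> and
  \<open>d dvd u\<close>. So \<open>s\<close> and \<open>u\<close> are themselves of the form
  \<open>c * a\<close> and \<open>d * b\<close>, and \<open>t\<close> splits as
  \<open>a + b\<close>.\<close>

theorem theorem2p3:
  fixes S T :: "nat set" and c d :: nat
  assumes "numerical_semigroup S" and "numerical_semigroup T"
    and "c > 0" and "d > 0" and "gcd c d = 1"
  shows "semigroup_quotient S c + semigroup_quotient T d
    = semigroup_quotient (d *o S + c *o T) (c * d)"
proof (intro equalityI subsetI)
  fix t
  assume "t \<in> semigroup_quotient S c + semigroup_quotient T d"
  then obtain a b where "t = a + b" "c * a \<in> S" "d * b \<in> T"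
    by (auto simp: semigroup_quotient_def elim: set_plus_elim)
  moreover from this have "c * d * t = d * (c * a) + c * (d * b)"
    by (simp add: algebra_simps)
  ultimately show "t \<in> semigroup_quotient (d *o S + c *o T) (c * d)"
    by (auto simp: semigroup_quotient_def intro: set_plus_intro set_times_intro2)
next
  fix t
  assume "t \<in> semigroup_quotient (d *o S + c *o T) (c * d)"
  then obtain s u where su: "s \<in> S" "u \<in> T" and eq: "c * d * t = d * s + c * u"
    by (auto simp: semigroup_quotient_def elt_set_times_def elim!: set_plus_elim)
  have cop: "coprime c d"
    using assms(5) by (simp add: coprime_iff_gcd_eq_1)
  \<comment> \<open>Modulo \<open>c\<close> both \<open>c * d * t\<close> and \<open>c * u\<close>
    vanish, leaving \<open>d * s\<close>, where \<open>d\<close> is invertible. The argument modulo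
    \<open>d\<close> is symmetric.\<close>
  have "c dvd d * s + c * u"
    unfolding eq[symmetric] by simp
  then have "c dvd d * s"
    by (simp add: dvd_add_left_iff)
  then have "c dvd s"
    using cop by (simp add: coprime_dvd_mult_right_iff)
  then obtain a where a: "s = c * a" ..
  have "d dvd d * s + c * u"
    unfolding eq[symmetric] by simp
  then have "d dvd c * u"
    by (simp add: dvd_add_right_iff)
  then have "d dvd u"
    using cop by (simp add: coprime_dvd_mult_right_iff coprime_commute)
  then obtain b where b: "u = d * b" ..
  have "c * d * t = c * d * (a + b)"
    using eq a b by (simp add: algebra_simps)
  \<comment> \<open>Cancelling \<open>c * d\<close> is legitimate because both factors are
    positive.\<close>
  then have "t = a + b"
    using assms(3,4) by simp
  then show "t \<in> semigroup_quotient S c + semigroup_quotient T d"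
    using su a b by (auto simp: semigroup_quotient_def intro: set_plus_intro)
qed

end
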